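(* Let $d\in(\tfrac12,1)$. In the square model at density $d$ a random group $G=\langle a_1,\dots,a_n\mid R_n\rangle$ is, with overwhelming probability, trivial in the sense that all its generators are equal: with probability tending to $1$ as $n\to\infty$, $a_1=a_2=\dots=a_n$ holds in $G$.
   Context: Square model: for $n\ge 1$ let $A_n=\{a_1,\dots,a_n\}$, let $F_n$ be the free group on $A_n$, and let $W'_n$ be the set of all cyclically reduced words of length four in the letters $a_i^{\pm1}$. For $d\in(0,1)$ choose a subset $R_n\subset W'_n$ with $|R_n|=\lfloor (2n-1)^{4d}\rfloor$ uniformly at random among all subsets of that size. The quotient $G=\langle A_n\mid R_n\rangle$ of $F_n$ by the normal closure of $R_n$ is a random group in the square model at density $d$. A property holds with overwhelming probability if the probability that the random group has it tends to $1$ as $n\to\infty$. *)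

theory Defs
  imports "HOL-Algebra.Algebra" "HOL-Probability.Probability"
begin

section \<open>Free groups\<close>

text \<open>
  A letter \<open>(a, True)\<close> stands for the generator \<open>a\<close> and \<open>(a, False)\<close> for its formal inverse.
  The free group on a set \<open>A\<close> is realised on the set of freely reduced words over \<open>A\<close>.
\<close>

type_synonym 'a letter = "'a \<times> bool"
type_synonym 'a word = "'a letter list"

definition inv_letter :: "'a letter \<Rightarrow> 'a letter" where
  "inv_letter x = (fst x, \<not> snd x)"

definition words :: "'a set \<Rightarrow> 'a word set" where
  "words A = lists (A \<times> UNIV)"

definition reduced :: "'a word \<Rightarrow> bool" where
  "reduced w \<longleftrightarrow> successively (\<lambda>x y. y \<noteq> inv_letter x) w"

definition cyclically_reduced :: "'a word \<Rightarrow> bool" where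
  "cyclically_reduced w \<longleftrightarrow> reduced w \<and> (w \<noteq> [] \<longrightarrow> hd w \<noteq> inv_letter (last w))"

text \<open>Left multiplication of a reduced word by a letter, with cancellation.\<close>

fun push :: "'a letter \<Rightarrow> 'a word \<Rightarrow> 'a word" where
  "push x [] = [x]"
| "push x (y # ys) = (if y = inv_letter x then ys else x # y # ys)"

definition free_reduce :: "'a word \<Rightarrow> 'a word" where
  "free_reduce w = foldr push w []"

definition free_group :: "'a set \<Rightarrow> 'a word monoid" where
  "free_group A = \<lparr>carrier = {w \<in> words A. reduced w},
                   monoid.mult = (\<lambda>u v. free_reduce (u @ v)),
                   one = []\<rparr>"

lemma inv_letter_inv_letter [simp]: "inv_letter (inv_letter x) = x"
  by (simp add: inv_letter_def)

lemma reduced_Nil [simp]: "reduced []"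
  by (simp add: reduced_def)

lemma reduced_Cons: "reduced (x # w) \<longleftrightarrow> reduced w \<and> (w = [] \<or> hd w \<noteq> inv_letter x)"
  by (auto simp: reduced_def successively_Cons)

lemma reduced_push: "reduced w \<Longrightarrow> reduced (push x w)"
  by (cases w) (auto simp: reduced_Cons)

lemma push_reduced: "reduced (x # w) \<Longrightarrow> push x w = x # w"
  by (cases w) (auto simp: reduced_Cons)

lemma push_inv_push: "reduced w \<Longrightarrow> push (inv_letter x) (push x w) = w"
  by (cases w) (auto simp: push_reduced)

lemma reduced_free_reduce: "reduced (free_reduce w)"
  by (induction w) (auto simp: free_reduce_def reduced_push)

lemma free_reduce_reduced: "reduced w \<Longrightarrow> free_reduce w = w"
  by (induction w) (auto simp: free_reduce_def reduced_Cons push_reduced)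

lemma foldr_push_push:
  assumes "reduced v"
  shows "foldr push (push x w) v = push x (foldr push w v)"
proof -
  have red: "reduced (foldr push u v)" for u
    using assms by (induction u) (auto simp: reduced_push)
  show ?thesis
  proof (cases w)
    case (Cons y ys)
    show ?thesis
      using Cons push_inv_push[OF red[of ys], of "inv_letter x"] by auto
  qed simp
qed

lemma foldr_push_free_reduce:
  "reduced v \<Longrightarrow> foldr push (free_reduce w) v = foldr push w v"
  by (induction w) (simp_all add: free_reduce_def foldr_push_push)

lemma free_reduce_append_left: "free_reduce (free_reduce u @ v) = free_reduce (u @ v)"
  using foldr_push_free_reduce[OF reduced_free_reduce, of u v]
  by (simp add: free_reduce_def)

lemma free_reduce_append_right: "free_reduce (u @ free_reduce v) = free_reduce (u @ v)"
  using free_reduce_reduced[OF reduced_free_reduce, of v] by (simp add: free_reduce_def)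

lemma push_in_words: "fst x \<in> A \<Longrightarrow> w \<in> words A \<Longrightarrow> push x w \<in> words A"
  by (cases x; cases w) (auto simp: words_def)

lemma free_reduce_in_words: "w \<in> words A \<Longrightarrow> free_reduce w \<in> words A"
proof (induction w)
  case (Cons x w)
  then show ?case
    using push_in_words[of x A "free_reduce w"] by (auto simp: words_def free_reduce_def)
qed (simp add: free_reduce_def)

lemma words_append: "u \<in> words A \<Longrightarrow> v \<in> words A \<Longrightarrow> u @ v \<in> words A"
  by (simp add: words_def)

lemma free_reduce_inverse: "free_reduce (rev (map inv_letter w) @ w) = []"
proof (induction w)
  case (Cons x w)
  have "push (inv_letter x) (push x (free_reduce w)) = free_reduce w"
    by (rule push_inv_push[OF reduced_free_reduce])
  then show ?case
    using Cons by (simp add: free_reduce_def)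
qed (simp add: free_reduce_def)

lemma group_free_group: "group (free_group A)"
proof (rule groupI)
  fix u v w
  show "u \<otimes>\<^bsub>free_group A\<^esub> v \<otimes>\<^bsub>free_group A\<^esub> w = u \<otimes>\<^bsub>free_group A\<^esub> (v \<otimes>\<^bsub>free_group A\<^esub> w)"
    by (simp add: free_group_def free_reduce_append_left free_reduce_append_right)
next
  fix w assume "w \<in> carrier (free_group A)"
  then have w: "w \<in> words A" by (simp add: free_group_def)
  define v where "v = free_reduce (rev (map inv_letter w))"
  have "rev (map inv_letter w) \<in> words A"
    using w by (fastforce simp: words_def inv_letter_def)
  then have "v \<in> carrier (free_group A)"
    by (simp add: v_def free_group_def free_reduce_in_words reduced_free_reduce)
  moreover have "v \<otimes>\<^bsub>free_group A\<^esub> w = \<one>\<^bsub>free_group A\<^esub>"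
    by (simp add: v_def free_group_def free_reduce_append_left free_reduce_inverse)
  ultimately show "\<exists>y\<in>carrier (free_group A). y \<otimes>\<^bsub>free_group A\<^esub> w = \<one>\<^bsub>free_group A\<^esub>"
    by blast
next
  show "\<one>\<^bsub>free_group A\<^esub> \<in> carrier (free_group A)"
    by (simp add: free_group_def words_def)
qed (auto simp: free_group_def free_reduce_in_words words_append reduced_free_reduce
        free_reduce_reduced)


section \<open>Presentations\<close>

definition normal_closure :: "('a, 'b) monoid_scheme \<Rightarrow> 'a set \<Rightarrow> 'a set" where
  "normal_closure G R = \<Inter>{N. N \<lhd> G \<and> R \<subseteq> N}"

lemma (in group) normal_closure_normal:
  assumes "R \<subseteq> carrier G"
  shows "normal_closure G R \<lhd> G"
proof -
  have "subgroup (normal_closure G R) G"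
    unfolding normal_closure_def
    using assms normal_self by (intro subgroups_Inter) (auto dest: normal_imp_subgroup)
  then show ?thesis
    by (rule normal_invI) (auto simp: normal_closure_def intro: normal_invE(2))
qed

definition presented_group :: "'a set \<Rightarrow> 'a word set \<Rightarrow> 'a word set monoid" where
  "presented_group A R = free_group A Mod normal_closure (free_group A) R"

lemma group_presented_group:
  assumes "R \<subseteq> carrier (free_group A)"
  shows "group (presented_group A R)"
  unfolding presented_group_def
  by (intro normal.factorgroup_is_group group.normal_closure_normal group_free_group assms)

text \<open>The image of the generator \<open>a\<close> under the quotient map from the free group.\<close>

definition presented_generator :: "'a set \<Rightarrow> 'a word set \<Rightarrow> 'a \<Rightarrow> 'a word set" where
  "presented_generator A R a =
     normal_closure (free_group A) R #>\<^bsub>free_group A\<^esub> [(a, True)]"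

lemma presented_generator_in_carrier:
  "a \<in> A \<Longrightarrow> presented_generator A R a \<in> carrier (presented_group A R)"
  by (auto simp: presented_generator_def presented_group_def carrier_FactGroup
      free_group_def words_def reduced_def)


section \<open>The square model\<close>

text \<open>The generator with name \<open>i\<close> in \<open>{1..n}\<close> is the letter \<open>a\<^sub>i\<close>.\<close>

definition square_relators :: "nat \<Rightarrow> nat word set" where
  "square_relators n = {w \<in> words {1..n}. length w = 4 \<and> cyclically_reduced w}"

lemma square_relators_subset: "square_relators n \<subseteq> carrier (free_group {1..n})"
  by (auto simp: square_relators_def free_group_def cyclically_reduced_def)

lemma finite_square_relators: "finite (square_relators n)"
proof (rule finite_subset)
  show "square_relators n \<subseteq> {w. set w \<subseteq> {1..n} \<times> UNIV \<and> length w = 4}"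
    by (auto simp: square_relators_def words_def)
qed (intro finite_lists_length_eq finite_cartesian_product; simp)

text \<open>
  There are \<open>(2n-1)^4 + (2n-1)\<close> cyclically reduced words of length four in \<open>n \<ge> 1\<close> letters, so
  for \<open>n \<ge> 1\<close> and \<open>0 < d < 1\<close> the sample space below is a nonempty finite set.
\<close>

definition square_relator_sets :: "real \<Rightarrow> nat \<Rightarrow> nat word set set" where
  "square_relator_sets d n =
     {R. R \<subseteq> square_relators n \<and> card R = nat \<lfloor>(2 * real n - 1) powr (4 * d)\<rfloor>}"

definition square_model :: "real \<Rightarrow> nat \<Rightarrow> nat word set pmf" where
  "square_model d n = pmf_of_set (square_relator_sets d n)"

text \<open>
  A property of the random group is given as a predicate \<open>P n R\<close> on the presentation
  \<open>\<langle>a\<^sub>1, \<dots>, a\<^sub>n | R\<rangle>\<close>, so that it may refer to the images of the generators in the group.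
\<close>

definition with_overwhelming_probability ::
    "real \<Rightarrow> (nat \<Rightarrow> nat word set \<Rightarrow> bool) \<Rightarrow> bool" where
  "with_overwhelming_probability d P \<longleftrightarrow>
     (\<lambda>n. measure_pmf.prob (square_model d n) {R. P n R}) \<longlonglongrightarrow> 1"

end

theory Submission
  imports Defs "HOL-Real_Asymp.Real_Asymp"
begin

text \<open>
  A positive relator \<open>a\<^sub>i a\<^sub>j a\<^sub>k a\<^sub>l\<close> is an edge joining \<open>(i, j)\<close> to \<open>(k, l)\<close> in a bipartite
  graph with \<open>n\<^sup>2\<close> vertices on each side; along it, \<open>a\<^sub>i a\<^sub>j\<close> equals the inverse of \<open>a\<^sub>k a\<^sub>l\<close> in
  the random group. If two generators differ, then the pairs representing a suitable group element
  give a nontrivial cut \<open>(S, T)\<close> crossed by no relator, and after complementing we may assume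
  \<open>|S| + |T| \<le> n\<^sup>2\<close>. At least \<open>n\<^sup>2 (|S| + |T|) / 2\<close> positive words cross such a cut, so it is
  avoided by the relators with probability at most \<open>r ^ (|S| + |T|)\<close>, where \<open>r\<close> decays faster
  than any power of \<open>n\<close> because \<open>d > 1/2\<close>. Summing over all nontrivial cuts bounds the failure
  probability by \<open>(1 + r) ^ (2 n\<^sup>2) - 1\<close>, which tends to \<open>0\<close>.
\<close>

section \<open>Random subsets of fixed size\<close>

text \<open>Deleting one element from a set of size \<open>l \<le> m\<close> scales the number of
  \<open>k\<close>-subsets by 1 - k/l, which is at most 1 - k/m and hence at most exp (-k/m), when
  \<open>k \<le> l\<close>; otherwise both counts are zero. Induction on \<open>f\<close> multiplies
  these factors.\<close>

lemma binomial_diff_le_exp: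
  assumes "f \<le> m"
  shows "real ((m - f) choose k) \<le> real (m choose k) * exp (- (real k * real f / real m))"
  using assms
proof (induction f)
  case (Suc f)
  define l where "l = m - f"
  have l: "0 < l" "l \<le> m" and eq: "m - Suc f = l - 1"
    using Suc.prems by (auto simp: l_def)
  have "real l * real ((l - 1) choose k) = real (l - k) * real (l choose k)"
    using binomial_absorb_comp[of l k] by (metis of_nat_mult)
  moreover have "real (l - k) * real (l choose k)
      \<le> real l * (exp (- (real k / real m)) * real (l choose k))"
  proof (cases "k \<le> l")
    case True
    have "real (l - k) = real l * (1 - real k / real l)"
      using True l by (simp add: of_nat_diff field_simps)
    also have "\<dots> \<le> real l * (1 - real k / real m)"
      using l by (intro mult_left_mono diff_left_mono divide_left_mono) auto
    also have "\<dots> \<le> real l * exp (- (real k / real m))"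
      using exp_ge_add_one_self[of "- (real k / real m)"] by (intro mult_left_mono) auto
    finally show ?thesis
      by (metis mult.assoc mult_right_mono of_nat_0_le_iff)
  qed simp
  ultimately have "real l * real ((l - 1) choose k)
      \<le> real l * (exp (- (real k / real m)) * real (l choose k))"
    by simp
  then have "real ((l - 1) choose k) \<le> exp (- (real k / real m)) * real (l choose k)"
    using l by simp
  also have "\<dots> \<le> exp (- (real k / real m)) *
      (real (m choose k) * exp (- (real k * real f / real m)))"
    using Suc by (intro mult_left_mono) (auto simp: l_def)
  also have "\<dots> = real (m choose k) * exp (- (real k * real (Suc f) / real m))"
    by (simp add: exp_add[symmetric] field_simps add_divide_distrib)
  finally show ?case
    by (simp only: eq)
qed simp

text \<open>The samples that miss \<open>F\<close> are the \<open>k\<close>-subsets of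
  \<open>W - F\<close>, so the probability is a quotient of two binomial coefficients. The bound on
  \<open>k\<close> keeps the sample space nonempty.\<close>

lemma prob_subset_disjoint_le:
  fixes W F :: "'a set"
  assumes W: "finite W" and F: "F \<subseteq> W" and k: "k \<le> card W"
  shows "measure_pmf.prob (pmf_of_set {R. R \<subseteq> W \<and> card R = k}) {R. R \<inter> F = {}}
      \<le> exp (- (real k * real (card F) / real (card W)))"
proof -
  let ?X = "{R. R \<subseteq> W \<and> card R = k}"
  have card: "card ?X = card W choose k"
    using W by (rule n_subsets)
  have pos: "0 < card ?X"
    using k by (simp add: card)
  have "?X \<inter> {R. R \<inter> F = {}} = {R. R \<subseteq> W - F \<and> card R = k}"
    by auto
  then have "card (?X \<inter> {R. R \<inter> F = {}}) = (card W - card F) choose k"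
    using n_subsets[of "W - F" k] W F by (simp add: card_Diff_subset finite_subset)
  moreover have "card F \<le> card W"
    using W F by (rule card_mono)
  ultimately have "real (card (?X \<inter> {R. R \<inter> F = {}}))
      \<le> real (card ?X) * exp (- (real k * real (card F) / real (card W)))"
    using binomial_diff_le_exp[of "card F" "card W" k] by (simp add: card)
  moreover have "?X \<noteq> {}" "finite ?X"
    using pos card_gt_0_iff by blast+
  ultimately show ?thesis
    using pos by (simp add: measure_pmf_of_set divide_le_eq mult.commute)
qed

text \<open>Each element of \<open>A\<close> contributes a factor 1 if left out and \<open>r\<close>
  if taken in. This evaluates the sum over all cuts in the union bound.\<close>

lemma sum_Pow_power_card:
  fixes r :: "'b :: comm_semiring_1"
  assumes "finite A"
  shows "(\<Sum>S\<in>Pow A. r ^ card S) = (1 + r) ^ card A"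
  using assms
proof induction
  case (insert x A)
  have inj: "inj_on (insert x) (Pow A)"
    using insert.hyps by (auto simp: inj_on_def)
  have "(\<Sum>S\<in>Pow (insert x A). r ^ card S)
      = (\<Sum>S\<in>Pow A. r ^ card S) + (\<Sum>S\<in>insert x ` Pow A. r ^ card S)"
    unfolding Pow_insert using insert.hyps by (intro sum.union_disjoint) auto
  also have "(\<Sum>S\<in>insert x ` Pow A. r ^ card S) = (\<Sum>S\<in>Pow A. r * r ^ card S)"
    unfolding sum.reindex[OF inj]
  proof (rule sum.cong)
    fix S assume "S \<in> Pow A"
    then have "finite S" "x \<notin> S"
      using insert.hyps finite_subset by auto
    then show "((\<lambda>S. r ^ card S) \<circ> insert x) S = r * r ^ card S"
      by simp
  qed simp
  finally show ?case
    using insert by (simp add: sum_distrib_left[symmetric] algebra_simps)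
qed simp

section \<open>Positive relators and cuts\<close>

definition positive_word :: "(nat \<times> nat) \<times> (nat \<times> nat) \<Rightarrow> nat word" where
  "positive_word p =
     [(fst (fst p), True), (snd (fst p), True), (fst (snd p), True), (snd (snd p), True)]"

lemma inj_positive_word: "inj_on positive_word A"
  by (auto simp: inj_on_def positive_word_def)

definition letter_pairs :: "nat \<Rightarrow> (nat \<times> nat) set" where
  "letter_pairs n = {1..n} \<times> {1..n}"

lemma finite_letter_pairs [simp]: "finite (letter_pairs n)"
  by (simp add: letter_pairs_def)

lemma card_letter_pairs [simp]: "card (letter_pairs n) = n\<^sup>2"
  by (simp add: letter_pairs_def power2_eq_square)

text \<open>Without inverse letters nothing cancels, not even cyclically, so every edge of the
  complete bipartite graph is an admissible relator.\<close>

lemma positive_word_in_square_relators: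
  "p \<in> letter_pairs n \<times> letter_pairs n \<Longrightarrow> positive_word p \<in> square_relators n"
  by (auto simp: positive_word_def letter_pairs_def square_relators_def words_def
      cyclically_reduced_def reduced_def inv_letter_def)

lemma card_square_relators_ge: "n ^ 4 \<le> card (square_relators n)"
proof -
  have "n ^ 4 = card (positive_word ` (letter_pairs n \<times> letter_pairs n))"
    by (simp add: card_image inj_positive_word card_cartesian_product flip: power_add)
  also have "\<dots> \<le> card (square_relators n)"
    by (intro card_mono finite_square_relators) (auto intro: positive_word_in_square_relators)
  finally show ?thesis .
qed

lemma card_square_relators_le: "card (square_relators n) \<le> 16 * n ^ 4"
proof -
  let ?L = "{1..n} \<times> (UNIV :: bool set)"
  have "card (square_relators n) \<le> card {w. set w \<subseteq> ?L \<and> length w = 4}"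
    by (intro card_mono finite_lists_length_eq)
      (auto simp: square_relators_def words_def)
  also have "\<dots> = (n * 2) ^ 4"
    by (subst card_lists_length_eq) (simp_all add: card_cartesian_product)
  finally show ?thesis
    by (simp add: power_mult_distrib)
qed

text \<open>These are the edges with exactly one end in the cut, where \<open>S\<close> holds its
  left vertices and \<open>T\<close> its right vertices.\<close>

definition crossing_words ::
    "nat \<Rightarrow> (nat \<times> nat) set \<Rightarrow> (nat \<times> nat) set \<Rightarrow> nat word set" where
  "crossing_words n S T =
     positive_word ` (S \<times> (letter_pairs n - T) \<union> (letter_pairs n - S) \<times> T)"

lemma crossing_words_subset:
  "S \<subseteq> letter_pairs n \<Longrightarrow> T \<subseteq> letter_pairs n \<Longrightarrow> crossing_words n S T \<subseteq> square_relators n"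
  unfolding crossing_words_def by (auto intro!: positive_word_in_square_relators)

text \<open>With sizes s, t and v = n^2 the count is s(v - t) + (v - s)t = v(s + t) - 2st. Here 2st
  is at most (s + t)^2 / 2, and s + t \<le> v bounds this by v(s + t) / 2.\<close>

lemma card_crossing_words_ge:
  assumes S: "S \<subseteq> letter_pairs n" and T: "T \<subseteq> letter_pairs n"
    and le: "card S + card T \<le> n\<^sup>2"
  shows "real (n\<^sup>2) * real (card S + card T) / 2 \<le> real (card (crossing_words n S T))"
proof -
  let ?V = "letter_pairs n"
  have fin: "finite S" "finite T"
    using S T finite_subset[OF _ finite_letter_pairs] by auto
  have "card (crossing_words n S T) = card (S \<times> (?V - T) \<union> (?V - S) \<times> T)"
    unfolding crossing_words_def by (rule card_image[OF inj_positive_word])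
  also have "\<dots> = card (S \<times> (?V - T)) + card ((?V - S) \<times> T)"
    using fin by (intro card_Un_disjoint) auto
  also have "\<dots> = card S * (n\<^sup>2 - card T) + (n\<^sup>2 - card S) * card T"
    using S T fin by (simp add: card_cartesian_product card_Diff_subset)
  finally have "real (card (crossing_words n S T))
      = real (card S) * (real (n\<^sup>2) - real (card T)) + (real (n\<^sup>2) - real (card S)) * real (card T)"
    using le by (simp only: of_nat_add of_nat_mult of_nat_diff)
  moreover have "v * (s + t) / 2 \<le> s * (v - t) + (v - s) * t"
    if "s + t \<le> v" "0 \<le> s" "0 \<le> t" for s t v :: real
  proof -
    have "(s + t) * (s + t) \<le> v * (s + t)"
      using that by (intro mult_right_mono) auto
    moreover have "0 \<le> (s - t) * (s - t)"
      by simp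
    ultimately show ?thesis
      by (simp add: algebra_simps add_divide_distrib)
  qed
  ultimately show ?thesis
    using le by (metis of_nat_0_le_iff of_nat_add of_nat_le_iff)
qed

section \<open>Relations in the presented group\<close>

text \<open>The product of the four cosets is the coset of a word in the normal closure, hence the
  identity of the quotient. The bracketing in pairs matches the two ends of the edge.\<close>

lemma positive_relator_trivial:
  assumes R: "R \<subseteq> carrier (free_group A)" and w: "positive_word ((a, b), (c, d)) \<in> R"
  shows "(presented_generator A R a \<otimes>\<^bsub>presented_group A R\<^esub> presented_generator A R b)
      \<otimes>\<^bsub>presented_group A R\<^esub>
      (presented_generator A R c \<otimes>\<^bsub>presented_group A R\<^esub> presented_generator A R d)
    = \<one>\<^bsub>presented_group A R\<^esub>"
proof -
  let ?F = "free_group A"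
  define N where "N = normal_closure ?F R"
  interpret F: group ?F by (rule group_free_group)
  interpret N: normal N ?F
    unfolding N_def using R by (rule F.normal_closure_normal)
  have "positive_word ((a, b), (c, d)) \<in> carrier ?F"
    using R w by blast
  then have gens: "{a, b, c, d} \<subseteq> A"
    by (auto simp: positive_word_def free_group_def words_def)
  have car: "[(x, True)] \<in> carrier ?F" "[(x, True), (y, True)] \<in> carrier ?F"
    if "x \<in> A" "y \<in> A" for x y
    using that by (auto simp: free_group_def words_def reduced_def inv_letter_def)
  have pair: "presented_generator A R x \<otimes>\<^bsub>presented_group A R\<^esub> presented_generator A R y
      = N #>\<^bsub>?F\<^esub> [(x, True), (y, True)]" if "x \<in> A" "y \<in> A" for x y
    using that N.rcos_sum[OF car(1)[of x x] car(1)[of y y]]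
    by (simp add: presented_generator_def presented_group_def FactGroup_def N_def[symmetric])
      (simp add: free_group_def free_reduce_def inv_letter_def)
  have "(N #>\<^bsub>?F\<^esub> [(a, True), (b, True)]) <#>\<^bsub>?F\<^esub> (N #>\<^bsub>?F\<^esub> [(c, True), (d, True)])
      = N #>\<^bsub>?F\<^esub> positive_word ((a, b), (c, d))"
    using N.rcos_sum[OF car(2)[of a b] car(2)[of c d]] gens
    by (simp add: positive_word_def)
      (simp add: free_group_def free_reduce_def inv_letter_def)
  moreover have "positive_word ((a, b), (c, d)) \<in> N"
    using w unfolding N_def normal_closure_def by blast
  then have "N #>\<^bsub>?F\<^esub> positive_word ((a, b), (c, d)) = N"
    by (rule N.rcos_const[OF F.is_group])
  ultimately show ?thesis
    using gens pair by (simp add: presented_group_def FactGroup_def N_def[symmetric])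
qed

lemma uncrossed_cut_if_generators_differ:
  assumes R: "R \<subseteq> square_relators n"
    and ij: "i \<in> {1..n}" "j \<in> {1..n}"
    and neq: "presented_generator {1..n} R i \<noteq> presented_generator {1..n} R j"
  obtains S T where "S \<subseteq> letter_pairs n" "T \<subseteq> letter_pairs n" "(S, T) \<noteq> ({}, {})"
    "card S + card T \<le> n\<^sup>2" "R \<inter> crossing_words n S T = {}"
proof -
  let ?V = "letter_pairs n"
  define G where "G = presented_group {1..n} R"
  define x where "x = presented_generator {1..n} R"
  have RF: "R \<subseteq> carrier (free_group {1..n})"
    using R square_relators_subset by blast
  interpret G: group G
    unfolding G_def using RF by (rule group_presented_group)
  have x: "x k \<in> carrier G" if "k \<in> {1..n}" for k
    unfolding x_def G_def using that by (rule presented_generator_in_carrier)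
  \<comment> \<open>With this \<open>g\<close> the pair \<open>(i, i)\<close> lies in
    \<open>S\<close>, while \<open>(i, j)\<close> does not, by cancelling \<open>x i\<close>. So
    both the cut and its complement are nontrivial.\<close>
  define g where "g = x i \<otimes>\<^bsub>G\<^esub> x i"
  define S where "S = {p \<in> ?V. x (fst p) \<otimes>\<^bsub>G\<^esub> x (snd p) = g}"
  define T where "T = {p \<in> ?V. inv\<^bsub>G\<^esub> (x (fst p) \<otimes>\<^bsub>G\<^esub> x (snd p)) = g}"
  have sub: "S \<subseteq> ?V" "T \<subseteq> ?V"
    by (auto simp: S_def T_def)
  have edge: "p \<in> S \<longleftrightarrow> q \<in> T"
    if pq: "p \<in> ?V" "q \<in> ?V" and w: "positive_word (p, q) \<in> R" for p q
  proof -
    let ?u = "x (fst p) \<otimes>\<^bsub>G\<^esub> x (snd p)" and ?v = "x (fst q) \<otimes>\<^bsub>G\<^esub> x (snd q)"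
    have car: "?u \<in> carrier G" "?v \<in> carrier G"
      using pq by (auto simp: letter_pairs_def intro!: x)
    have "?u \<otimes>\<^bsub>G\<^esub> ?v = \<one>\<^bsub>G\<^esub>"
      unfolding x_def G_def using w by (intro positive_relator_trivial[OF RF]) simp
    then have "inv\<^bsub>G\<^esub> ?v = ?u"
      using car by (intro G.inv_equality) auto
    then show ?thesis
      using pq by (simp add: S_def T_def)
  qed
  \<comment> \<open>Since \<open>edge\<close> is an equivalence, it survives complementing both
    sides.\<close>
  have uncrossed: "R \<inter> crossing_words n S T = {}"
      "R \<inter> crossing_words n (?V - S) (?V - T) = {}"
    using edge sub unfolding crossing_words_def by blast+
  have "(i, i) \<in> S"
    using ij by (simp add: S_def letter_pairs_def g_def)
  moreover have "(i, j) \<in> ?V - S"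
    using ij neq x by (auto simp: S_def letter_pairs_def g_def x_def)
  \<comment> \<open>The sizes of a cut and its complement add up to twice the threshold, so at least
    one of them stays within it.\<close>
  moreover have "card (?V - S) + card (?V - T) + (card S + card T) = 2 * n\<^sup>2"
    using card_mono[OF finite_letter_pairs sub(1)] card_mono[OF finite_letter_pairs sub(2)] sub
      finite_subset[OF _ finite_letter_pairs]
    by (simp add: card_Diff_subset)
  then have "card S + card T \<le> n\<^sup>2 \<or> card (?V - S) + card (?V - T) \<le> n\<^sup>2"
    by linarith
  ultimately show thesis
    using that[of S T] that[of "?V - S" "?V - T"] sub uncrossed by blast
qed

section \<open>The union bound\<close>

text \<open>The 32 combines the 1/2 from the count of crossing words with the 16 from the upper
  bound 16 n^4 on the number of relators. The bound \<open>k \<le> n ^ 4\<close> guarantees that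
  there are enough relators to draw from.\<close>

lemma prob_uncrossed_cut_le:
  assumes n: "0 < n" and S: "S \<subseteq> letter_pairs n" and T: "T \<subseteq> letter_pairs n"
    and le: "card S + card T \<le> n\<^sup>2"
    and k: "nat \<lfloor>(2 * real n - 1) powr (4 * d)\<rfloor> = k" "k \<le> n ^ 4"
  shows "measure_pmf.prob (square_model d n) {R. R \<inter> crossing_words n S T = {}}
      \<le> exp (- (real k / (32 * real n ^ 2))) ^ (card S + card T)"
proof -
  let ?W = "square_relators n" and ?F = "crossing_words n S T"
  let ?m = "card S + card T"
  have kW: "k \<le> card ?W"
    using k(2) card_square_relators_ge[of n] by linarith
  have W: "0 < card ?W" "real (card ?W) \<le> 16 * real n ^ 4"
  proof -
    show "0 < card ?W"
      using card_square_relators_ge[of n] n by (meson less_le_trans zero_less_power)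
    show "real (card ?W) \<le> 16 * real n ^ 4"
      using card_square_relators_le[of n] of_nat_mono by fastforce
  qed
  have "measure_pmf.prob (square_model d n) {R. R \<inter> ?F = {}}
      \<le> exp (- (real k * real (card ?F) / real (card ?W)))"
    unfolding square_model_def square_relator_sets_def k(1)
    by (intro prob_subset_disjoint_le finite_square_relators crossing_words_subset S T kW)
  also have "\<dots> \<le> exp (- (real ?m * (real k / (32 * real n ^ 2))))"
  proof -
    have "real ?m * (real k / (32 * real n ^ 2))
        = real k * (real (n\<^sup>2) * real ?m / 2) / (16 * real n ^ 4)"
      using n by (simp add: field_simps power2_eq_square power4_eq_xxxx)
    also have "\<dots> \<le> real k * real (card ?F) / real (card ?W)"
      using W card_crossing_words_ge[OF S T le] by (intro frac_le mult_left_mono) auto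
    finally show ?thesis
      by simp
  qed
  also have "\<dots> = exp (- (real k / (32 * real n ^ 2))) ^ ?m"
    using exp_of_nat_mult[of ?m "- (real k / (32 * real n ^ 2))"] by simp
  finally show ?thesis .
qed

lemma prob_generators_differ_le:
  assumes n: "0 < n"
    and k: "nat \<lfloor>(2 * real n - 1) powr (4 * d)\<rfloor> = k" "k \<le> n ^ 4"
  shows "measure_pmf.prob (square_model d n)
      {R. \<not> (\<forall>i\<in>{1..n}. \<forall>j\<in>{1..n}.
        presented_generator {1..n} R i = presented_generator {1..n} R j)}
    \<le> exp (2 * real n ^ 2 * exp (- (real k / (32 * real n ^ 2)))) - 1"
    (is "measure_pmf.prob ?M ?bad \<le> _")
proof -
  let ?V = "letter_pairs n" and ?W = "square_relators n"
  define r where "r = exp (- (real k / (32 * real n ^ 2)))"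
  define C where "C = Pow ?V \<times> Pow ?V"
  define C' where "C' = {p \<in> C - {({}, {})}. card (fst p) + card (snd p) \<le> n\<^sup>2}"
  define E where "E p = {R. R \<inter> crossing_words n (fst p) (snd p) = {}}" for p
  have finC: "finite C"
    by (simp add: C_def)
  have finC': "finite C'"
    using finC by (simp add: C'_def)
  \<comment> \<open>The sample space is nonempty, so it is the support of the distribution.
    Restricting to the support ensures that \<open>R\<close> consists of square relators, as the cut
    argument requires.\<close>
  have "k \<le> card ?W"
    using k(2) card_square_relators_ge[of n] by linarith
  then obtain R0 where "R0 \<subseteq> ?W" "card R0 = k"
    using obtain_subset_with_card_n by metis
  moreover have fin: "finite (square_relator_sets d n)"
    by (rule finite_subset[of _ "Pow ?W"])
      (auto simp: square_relator_sets_def finite_square_relators)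
  ultimately have supp: "set_pmf ?M = square_relator_sets d n"
    unfolding square_model_def using k(1)
    by (intro set_pmf_of_set) (auto simp: square_relator_sets_def)
  have "measure_pmf.prob ?M ?bad \<le> measure_pmf.prob ?M (\<Union>p\<in>C'. E p)"
  proof (rule measure_pmf.finite_measure_mono_AE)
    show "AE R in measure_pmf ?M. R \<in> ?bad \<longrightarrow> R \<in> (\<Union>p\<in>C'. E p)"
    proof (intro AE_pmfI impI)
      fix R assume "R \<in> set_pmf ?M" "R \<in> ?bad"
      then have R: "R \<subseteq> ?W"
        by (simp add: supp square_relator_sets_def)
      from \<open>R \<in> ?bad\<close> obtain i j where ij: "i \<in> {1..n}" "j \<in> {1..n}"
        "presented_generator {1..n} R i \<noteq> presented_generator {1..n} R j"
        by blast
      obtain S T where "S \<subseteq> ?V" "T \<subseteq> ?V" "(S, T) \<noteq> ({}, {})"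
        "card S + card T \<le> n\<^sup>2" "R \<inter> crossing_words n S T = {}"
        by (rule uncrossed_cut_if_generators_differ[OF R ij])
      then have "(S, T) \<in> C'" "R \<in> E (S, T)"
        by (auto simp: C'_def C_def E_def)
      then show "R \<in> (\<Union>p\<in>C'. E p)"
        by blast
    qed
  qed simp
  also have "\<dots> \<le> (\<Sum>p\<in>C'. measure_pmf.prob ?M (E p))"
    using finC' by (intro measure_pmf.finite_measure_subadditive_finite) auto
  also have "\<dots> \<le> (\<Sum>p\<in>C'. r ^ (card (fst p) + card (snd p)))"
    unfolding E_def r_def
    by (intro sum_mono prob_uncrossed_cut_le n k) (auto simp: C'_def C_def)
  \<comment> \<open>Dropping the size restriction only adds nonnegative terms and lets the sum
    factor over \<open>S\<close> and \<open>T\<close>.\<close>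
  also have "\<dots> \<le> (\<Sum>p\<in>C - {({}, {})}. r ^ (card (fst p) + card (snd p)))"
    using finC by (intro sum_mono2) (auto simp: C'_def r_def)
  \<comment> \<open>The trivial cut contributes \<open>r ^ 0 = 1\<close>.\<close>
  also have "\<dots> = (\<Sum>p\<in>C. r ^ (card (fst p) + card (snd p))) - 1"
    using finC by (subst sum_diff1) (auto simp: C_def)
  also have "(\<Sum>p\<in>C. r ^ (card (fst p) + card (snd p)))
      = (\<Sum>S\<in>Pow ?V. r ^ card S) * (\<Sum>T\<in>Pow ?V. r ^ card T)"
    by (simp add: C_def sum_product sum.cartesian_product power_add case_prod_unfold)
  also have "\<dots> = (1 + r) ^ (2 * n\<^sup>2)"
    by (simp add: sum_Pow_power_card mult_2 power_add)
  also have "\<dots> \<le> exp r ^ (2 * n\<^sup>2)"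
    using exp_ge_add_one_self[of r] by (intro power_mono) (auto simp: r_def)
  also have "\<dots> = exp (2 * real n ^ 2 * r)"
    using exp_of_nat_mult[of "2 * n\<^sup>2" r] by simp
  finally show ?thesis
    by (simp add: r_def)
qed

theorem theorem2p8:
  fixes d :: real
  assumes "1 / 2 < d" and "d < 1"
  shows "with_overwhelming_probability d
           (\<lambda>n R. \<forall>i\<in>{1..n}. \<forall>j\<in>{1..n}.
              presented_generator {1..n} R i = presented_generator {1..n} R j)"
proof -
  define k where "k n = nat \<lfloor>(2 * real n - 1) powr (4 * d)\<rfloor>" for n
  define P where "P n R \<longleftrightarrow> (\<forall>i\<in>{1..n}. \<forall>j\<in>{1..n}.
      presented_generator {1..n} R i = presented_generator {1..n} R j)" for n :: nat and R
  \<comment> \<open>Here the rounded sample size is replaced by its lower bound without the floor,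
    which leaves an explicit expression for the asymptotics.\<close>
  define e where
    "e n = exp (2 * real n ^ 2 * exp (- (((2 * real n - 1) powr (4 * d) - 1) / (32 * real n ^ 2)))) - 1"
    for n
  have d: "0 < 4 * d - 2" "0 < 4 - 4 * d" "0 < d"
    using assms by auto
  \<comment> \<open>This uses d < 1: the left side has order n^(4d) with 4d < 4.\<close>
  have "eventually (\<lambda>n. (2 * real n - 1) powr (4 * d) \<le> real n ^ 4) sequentially"
    using d by real_asymp
  then have bound: "eventually (\<lambda>n. measure_pmf.prob (square_model d n) {R. P n R} \<ge> 1 - e n) sequentially"
    using eventually_gt_at_top[of 0]
  proof eventually_elim
    case (elim n)
    have "real (k n) \<le> real n ^ 4"
      using elim(1) unfolding k_def
      by (metis of_nat_floor order.trans powr_ge_zero)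
    then have kn: "k n \<le> n ^ 4"
      by (simp flip: of_nat_power)
    have k_ge: "(2 * real n - 1) powr (4 * d) - 1 \<le> real (k n)"
      unfolding k_def by linarith
    have "measure_pmf.prob (square_model d n) {R. \<not> P n R}
        \<le> exp (2 * real n ^ 2 * exp (- (real (k n) / (32 * real n ^ 2)))) - 1"
      unfolding P_def using elim(2) kn by (intro prob_generators_differ_le) (auto simp: k_def)
    also have "\<dots> \<le> e n"
      unfolding e_def using k_ge
      by (auto intro!: mult_left_mono divide_right_mono)
    finally show ?case
      using measure_pmf.prob_compl[of "{R. P n R}" "square_model d n"]
      by (simp add: Compl_eq_Diff_UNIV[symmetric] Collect_neg_eq[symmetric])
  qed
  \<comment> \<open>This uses d > 1/2: the inner exponent tends to minus infinity at the rate n^(4d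
    - 2), so its exponential outweighs the factor 2 n^2.\<close>
  have "e \<longlonglongrightarrow> 0"
    unfolding e_def using d by real_asymp
  then have lim: "(\<lambda>n. 1 - e n) \<longlonglongrightarrow> 1"
    using tendsto_diff[OF tendsto_const, of e 0 sequentially 1] by simp
  have "(\<lambda>n. measure_pmf.prob (square_model d n) {R. P n R}) \<longlonglongrightarrow> 1"
    by (rule tendsto_sandwich[OF bound _ lim tendsto_const]) simp
  then show ?thesis
    by (simp add: with_overwhelming_probability_def P_def)
qed

end
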